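(* Let $j\in\{2,3,4\}$, $\lambda\in\{1,-1\}$, let $r>0$ be constant, and let $\beta$ be a unit-speed spacelike curve in $\mathbb{E}^4_1$ with non-null Frenet frame $\{F_1,F_2,F_3,F_4\}$ whose timelike member is $F_j$, and with first curvature $k_1$. Let $M$ be the tubular hypersurface $$\mathcal{T}^{\{j,\lambda\}}(s,t,w)=\beta(s)+r\sum_{i=2}^4\mu_i^{\lambda}F_i(s)$$ with Gauss map $N^{\{j,\lambda\}}=-(-1)^{(4-j)!}\lambda^j\sum_{i=2}^4\mu_i^\lambda F_i$. Then $M$ has first kind $\mathcal{L}_1$-(global) pointwise 1-type Gauss map, i.e. $\mathcal{L}_1N^{\{j,\lambda\}}=\mathfrak{m}N^{\{j,\lambda\}}$ with $\mathfrak{m}$ a non-zero constant, if and only if $k_1=0$ (identically); here $\mathfrak{m}=\frac{2\lambda^{j+1}(-1)^{(4-j)!}}{r^3}$.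
   Context: $\mathbb{E}^4_1$ is $\mathbb{R}^4$ with the metric $\langle\ ,\ \rangle=-dx_1^2+dx_2^2+dx_3^2+dx_4^2$. The curve $\beta:I\to\mathbb{E}^4_1$ ($I$ an open interval) is smooth with $\beta'=F_1$, and $\{F_1,\dots,F_4\}$ is a smooth orthonormal frame along $\beta$ with $\langle F_j,F_j\rangle=-1$ and $\langle F_i,F_i\rangle=1$ for $i\neq j$, satisfying, with smooth curvature functions $k_1,k_2,k_3$ of $s$ (allowed to vanish), the Frenet equations - $j=2$: $F_1'=k_1F_2$, $F_2'=k_1F_1+k_2F_3$, $F_3'=k_2F_2+k_3F_4$, $F_4'=-k_3F_3$; - $j=3$: $F_1'=k_1F_2$, $F_2'=-k_1F_1+k_2F_3$, $F_3'=k_2F_2+k_3F_4$, $F_4'=k_3F_3$; - $j=4$: $F_1'=k_1F_2$, $F_2'=-k_1F_1+k_2F_3$, $F_3'=-k_2F_2+k_3F_4$, $F_4'=k_3F_3$. The functions $\mu_i^\lambda$ (depending on $j$) are given by $\mu_j^\lambda=(\sinh w)^{\frac{1+\lambda}2}(\cosh w)^{\frac{1-\lambda}2}\cosh t$, $\mu_{j+1}^\lambda=(\sinh w)^{\frac{1-\lambda}2}(\cosh w)^{\frac{1+\lambda}2}$, $\mu_{j+2}^\lambda=(\sinh w)^{\frac{1+\lambda}2}(\cosh w)^{\frac{1-\lambda}2}\sinh t$, with the index convention $\mu_5^\lambda=\mu_2^\lambda$, $\mu_6^\lambda=\mu_3^\lambda$. ($\lambda=1$: envelope of pseudo hyperspheres;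 $\lambda=-1$: envelope of pseudo hyperbolic hyperspheres, of radius $r$ centered on $\beta$.) The parameters $(s,t,w)$ range over a connected open set $U\subset I\times\mathbb{R}^2$ projecting onto $I$ on which $\mathcal{T}^{\{j,\lambda\}}$ is an immersion, i.e. $(\mu_{j+1}^\lambda)_w\neq0$ and $1+(-1)^{(4-j)!}rk_1\mu_2^\lambda\neq0$. The unit normal $N=N^{\{j,\lambda\}}$ has $\varepsilon=\langle N,N\rangle=\lambda$, and the principal curvatures with respect to $N$ (eigenvalues of $-dN$) are $\kappa_1=\kappa_2=\frac{(-1)^{(4-j)!}\lambda^j}{r}$, $\kappa_3=\frac{k_1\mu_2^\lambda}{\lambda^j(1+(-1)^{(4-j)!}rk_1\mu_2^\lambda)}$. Operator $\mathcal{L}_1$ (Cheng–Yau) on the Gauss map: put $a_1=-\sum_i\kappa_i$, $a_k=(-1)^k\sum_{i_1<\dots<i_k}\kappa_{i_1}\cdots\kappa_{i_k}$ ($k=2,3$), and define $H_k$ by $\binom{3}{k}H_k=(-\varepsilon)^ka_k$. Then $$\mathcal{L}_1N=-\varepsilon\,\mathfrak{C}_1\big(\nabla H_2+(3H_1H_2-H_3)N\big),\qquad \mathfrak{C}_1=\binom32(-\varepsilon)=-3\varepsilon,$$ where $\nabla$ is the gradient on $M$ with respect to the induced metric, viewed as an $\mathbb{E}^4_1$-valued map. $M$ has first kind $\mathcal{L}_1$-pointwise 1-type Gauss map if $\mathcal{L}_1N=\mathfrak{m}N$ for a non-zero smooth function $\mathfrak{m}$ on $M$; the word "(global)" is added when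 $\mathfrak{m}$ is constant. *)

theory Defs
  imports "HOL-Analysis.Analysis" "HOL-Computational_Algebra.Polynomial" "HOL-Library.Multiset"
begin

section \<open>Minkowski space and curves\<close>

definition lorentz :: "real ^ 4 \<Rightarrow> real ^ 4 \<Rightarrow> real" where
  "lorentz x y = - (x $ 1 * y $ 1) + x $ 2 * y $ 2 + x $ 3 * y $ 3 + x $ 4 * y $ 4"

text \<open>Infinitely differentiable functions of one variable, meant for open sets; \<open>D n\<close> is the
  \<open>n\<close>-th derivative.\<close>

definition smooth_curve_on :: "real set \<Rightarrow> (real \<Rightarrow> 'a::real_normed_vector) \<Rightarrow> bool" where
  "smooth_curve_on I f \<longleftrightarrow>
     (\<exists>D :: nat \<Rightarrow> real \<Rightarrow> 'a. (\<forall>s\<in>I. D 0 s = f s) \<and>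
        (\<forall>n. \<forall>s\<in>I. (D n has_vector_derivative D (Suc n) s) (at s)))"

definition orthonormal_frame :: "nat \<Rightarrow> real set \<Rightarrow> (nat \<Rightarrow> real \<Rightarrow> real ^ 4) \<Rightarrow> bool" where
  "orthonormal_frame j I F \<longleftrightarrow>
     (\<forall>s\<in>I. \<forall>a\<in>{1..4}. \<forall>b\<in>{1..4}.
        lorentz (F a s) (F b s) = (if a = b then (if a = j then -1 else 1) else 0))"

text \<open>Right-hand side of the Frenet equations of a curve whose timelike frame vector is
  \<open>F j\<close>.\<close>

definition frenet_rhs ::
  "nat \<Rightarrow> (nat \<Rightarrow> real \<Rightarrow> real ^ 4) \<Rightarrow> (nat \<Rightarrow> real \<Rightarrow> real) \<Rightarrow> nat \<Rightarrow> real \<Rightarrow> real ^ 4" where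
  "frenet_rhs j F k i s =
     (if i = 1 then k 1 s *\<^sub>R F 2 s
      else if i = 2 then (if j = 2 then k 1 s else - k 1 s) *\<^sub>R F 1 s + k 2 s *\<^sub>R F 3 s
      else if i = 3 then (if j = 4 then - k 2 s else k 2 s) *\<^sub>R F 2 s + k 3 s *\<^sub>R F 4 s
      else (if j = 2 then - k 3 s else k 3 s) *\<^sub>R F 3 s)"

definition spacelike_frenet_curve ::
  "nat \<Rightarrow> real set \<Rightarrow> (real \<Rightarrow> real ^ 4) \<Rightarrow> (nat \<Rightarrow> real \<Rightarrow> real ^ 4) \<Rightarrow> (nat \<Rightarrow> real \<Rightarrow> real) \<Rightarrow> bool"
  where
  "spacelike_frenet_curve j I \<beta> F k \<longleftrightarrow>
     smooth_curve_on I \<beta> \<and>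
     (\<forall>i\<in>{1..4}. smooth_curve_on I (F i)) \<and>
     (\<forall>i\<in>{1..3}. smooth_curve_on I (k i)) \<and>
     orthonormal_frame j I F \<and>
     (\<forall>s\<in>I. (\<beta> has_vector_derivative F 1 s) (at s)) \<and>
     (\<forall>i\<in>{1..4}. \<forall>s\<in>I. (F i has_vector_derivative frenet_rhs j F k i s) (at s))"


section \<open>Parametrized hypersurfaces and their Gauss maps\<close>

text \<open>A hypersurface is given by a parametrization \<open>X\<close> on an open set of \<open>real ^ 3\<close>, with unit
  normal field \<open>N\<close>; functions on the hypersurface are functions of the parameters.\<close>

definition immersion_on :: "(real ^ 3) set \<Rightarrow> (real ^ 3 \<Rightarrow> real ^ 4) \<Rightarrow> bool" where
  "immersion_on U X \<longleftrightarrow>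
     (\<forall>p\<in>U. X differentiable (at p) \<and> inj (frechet_derivative X (at p)))"

text \<open>The shape operator \<open>-dN\<close>, transported to the parameter space by \<open>dX\<close>.\<close>

definition shape_operator ::
  "(real ^ 3 \<Rightarrow> real ^ 4) \<Rightarrow> (real ^ 3 \<Rightarrow> real ^ 4) \<Rightarrow> real ^ 3 \<Rightarrow> real ^ 3 \<Rightarrow> real ^ 3" where
  "shape_operator X N p v =
     (THE u. frechet_derivative X (at p) u = - frechet_derivative N (at p) v)"

definition charpoly :: "real ^ 'n ^ 'n \<Rightarrow> real poly" where
  "charpoly A = det (mat [:0, 1:] - map_matrix (\<lambda>a. [:a:]) A)"

text \<open>Eigenvalues of the shape operator, listed with algebraic multiplicity. Only real eigenvalues
  are listed; for an indefinite metric there may be fewer than three.\<close>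

definition principal_curvatures ::
  "(real ^ 3 \<Rightarrow> real ^ 4) \<Rightarrow> (real ^ 3 \<Rightarrow> real ^ 4) \<Rightarrow> real ^ 3 \<Rightarrow> real list" where
  "principal_curvatures X N p =
     sorted_list_of_multiset (proots (charpoly (matrix (shape_operator X N p))))"

definition curvature_coeff ::
  "(real ^ 3 \<Rightarrow> real ^ 4) \<Rightarrow> (real ^ 3 \<Rightarrow> real ^ 4) \<Rightarrow> nat \<Rightarrow> real ^ 3 \<Rightarrow> real" where
  "curvature_coeff X N k p =
     (let \<kappa> = principal_curvatures X N p
      in (-1) ^ k * (\<Sum>A\<in>{A. A \<subseteq> {..<length \<kappa>} \<and> card A = k}. \<Prod>i\<in>A. \<kappa> ! i))"

definition normal_sign :: "(real ^ 3 \<Rightarrow> real ^ 4) \<Rightarrow> real ^ 3 \<Rightarrow> real" where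
  "normal_sign N p = lorentz (N p) (N p)"

definition mean_curvature ::
  "(real ^ 3 \<Rightarrow> real ^ 4) \<Rightarrow> (real ^ 3 \<Rightarrow> real ^ 4) \<Rightarrow> nat \<Rightarrow> real ^ 3 \<Rightarrow> real" where
  "mean_curvature X N k p =
     (- normal_sign N p) ^ k * curvature_coeff X N k p / real (3 choose k)"

text \<open>Gradient with respect to the induced metric, as a tangent vector in \<open>real ^ 4\<close>.\<close>

definition hypersurface_gradient ::
  "(real ^ 3 \<Rightarrow> real ^ 4) \<Rightarrow> (real ^ 3 \<Rightarrow> real) \<Rightarrow> real ^ 3 \<Rightarrow> real ^ 4" where
  "hypersurface_gradient X f p =
     (THE V. V \<in> range (frechet_derivative X (at p)) \<and>
        (\<forall>u. lorentz V (frechet_derivative X (at p) u) = frechet_derivative f (at p) u))"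

text \<open>The Cheng--Yau operator applied to the Gauss map. Componentwise it is the trace of the
  composition of the first Newton transformation \<open>a\<^sub>1 I + S\<close> (\<open>S\<close> the shape operator) with the
  Hessian of \<open>N\<close>; the closed form below is taken as the definition.\<close>

definition L1_Gauss ::
  "(real ^ 3 \<Rightarrow> real ^ 4) \<Rightarrow> (real ^ 3 \<Rightarrow> real ^ 4) \<Rightarrow> real ^ 3 \<Rightarrow> real ^ 4" where
  "L1_Gauss X N p =
     (let \<epsilon> = normal_sign N p;
          C1 = real (3 choose 2) * (- \<epsilon>);
          H = (\<lambda>k. mean_curvature X N k p)
      in (- \<epsilon> * C1) *\<^sub>R
           (hypersurface_gradient X (mean_curvature X N 2) p + (3 * H 1 * H 2 - H 3) *\<^sub>R N p))"

text \<open>First kind \<open>L\<^sub>1\<close>-(global) pointwise 1-type Gauss map, with constant factor \<open>m\<close>.\<close>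

definition first_kind_L1_global ::
  "(real ^ 3) set \<Rightarrow> (real ^ 3 \<Rightarrow> real ^ 4) \<Rightarrow> (real ^ 3 \<Rightarrow> real ^ 4) \<Rightarrow> real \<Rightarrow> bool" where
  "first_kind_L1_global U X N m \<longleftrightarrow> m \<noteq> 0 \<and> (\<forall>p\<in>U. L1_Gauss X N p = m *\<^sub>R N p)"


section \<open>Tubular hypersurfaces\<close>

text \<open>For \<open>i\<close> and \<open>j\<close> in \<open>{2..4}\<close>. The second disjuncts encode the cyclic convention on indices:
  5 stands for 2 and 6 for 3. With \<open>lam\<close> either 1 or -1 the exponents are 0 or 1.\<close>

definition tube_mu :: "nat \<Rightarrow> int \<Rightarrow> nat \<Rightarrow> real \<Rightarrow> real \<Rightarrow> real" where
  "tube_mu j lam i t w =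
     (if i = j then
        sinh w powi ((1 + lam) div 2) * cosh w powi ((1 - lam) div 2) * cosh t
      else if i = j + 1 \<or> i + 3 = j + 1 then
        sinh w powi ((1 - lam) div 2) * cosh w powi ((1 + lam) div 2)
      else if i = j + 2 \<or> i + 3 = j + 2 then
        sinh w powi ((1 + lam) div 2) * cosh w powi ((1 - lam) div 2) * sinh t
      else 0)"

text \<open>The parameters \<open>(s, t, w)\<close> are the components of \<open>p\<close>.\<close>

definition tube ::
  "nat \<Rightarrow> int \<Rightarrow> real \<Rightarrow> (real \<Rightarrow> real ^ 4) \<Rightarrow> (nat \<Rightarrow> real \<Rightarrow> real ^ 4) \<Rightarrow> real ^ 3 \<Rightarrow> real ^ 4" where
  "tube j lam r \<beta> F p =
     \<beta> (p $ 1) + r *\<^sub>R (\<Sum>i=2..4. tube_mu j lam i (p $ 2) (p $ 3) *\<^sub>R F i (p $ 1))"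

definition tube_normal ::
  "nat \<Rightarrow> int \<Rightarrow> (nat \<Rightarrow> real \<Rightarrow> real ^ 4) \<Rightarrow> real ^ 3 \<Rightarrow> real ^ 4" where
  "tube_normal j lam F p =
     (- ((-1) ^ fact (4 - j)) * real_of_int lam ^ j) *\<^sub>R
       (\<Sum>i=2..4. tube_mu j lam i (p $ 2) (p $ 3) *\<^sub>R F i (p $ 1))"

end

theory Submission
  imports Defs
begin

text \<open>
  Write \<open>N = c Y\<close> and \<open>X = \<beta> + r Y\<close> with \<open>c\<^sup>2 = 1\<close> and \<open>\<langle>Y, Y\<rangle> = \<lambda>\<close>. Since \<open>dX\<close> is injective, its range
  is the whole orthogonal complement of \<open>N\<close>; hence \<open>F\<^sub>1 = dX e\<close> for some \<open>e\<close>, and \<open>dX = F\<^sub>1 ds + r dY\<close>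
  gives the shape operator \<open>v \<mapsto> \<kappa> (v - v\<^sub>1 e)\<close> with \<open>\<kappa> = -c/r\<close>. Its eigenvalues are
  \<open>\<kappa>, \<kappa>, \<kappa>\<theta>\<close>, where \<open>\<theta> = 1 - e\<^sub>1 = 1 - 1/(1 + r\<rho>)\<close> and \<open>\<rho> = \<plusminus>k\<^sub>1\<mu>\<^sub>2\<close>. Separating tangential and normal parts,
  \<open>L\<^sub>1 N = m N\<close> means that \<open>dH\<^sub>2 = 0\<close> and \<open>m = 2\<lambda>\<kappa>\<^sup>3(1 + \<theta> + \<theta>\<^sup>2)\<close>. The first condition forces \<open>\<theta>\<close>,
  and with it \<open>k\<^sub>1\<mu>\<^sub>2\<close>, to be constant on the connected set \<open>U\<close>; as \<open>\<mu>\<^sub>2\<close> is nowhere locally constant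
  in \<open>(t, w)\<close>, this means \<open>k\<^sub>1 = 0\<close>.
\<close>

section \<open>Nondegenerate hyperplanes of Minkowski space\<close>

text \<open>The interpretation built on it supplies the algebraic rules and the product rule
  \<open>lorentz.FDERIV\<close>, by which orthogonality relations are differentiated.\<close>

lemma bounded_bilinear_lorentz: "bounded_bilinear lorentz"
proof -
  have "bilinear lorentz"
    unfolding bilinear_def linear_iff by (simp add: lorentz_def algebra_simps)
  then show ?thesis
    by (simp add: bilinear_conv_bounded_bilinear)
qed

interpretation lorentz: bounded_bilinear lorentz
  by (rule bounded_bilinear_lorentz)

lemma lorentz_commute: "lorentz x y = lorentz y x"
  by (simp add: lorentz_def algebra_simps)

text \<open>Composing with this reflection turns the Lorentz form into the inner product, so that
  the dimension formula for Euclidean hyperplanes applies.\<close>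

definition time_reflection :: "real ^ 4 \<Rightarrow> real ^ 4" where
  "time_reflection x = (\<chi> i. if i = 1 then - x $ 1 else x $ i)"

lemma lorentz_eq_inner: "lorentz x y = time_reflection x \<bullet> y"
  by (simp add: lorentz_def time_reflection_def inner_vec_def sum_4)

lemma lorentz_nondegenerate:
  assumes "\<And>y. lorentz x y = 0"
  shows "x = 0"
proof -
  have "lorentz x (axis i 1) = 0" for i using assms by blast
  from this[of 1] this[of 2] this[of 3] this[of 4] show ?thesis
    by (simp add: lorentz_def axis_def vec_eq_iff forall_4)
qed

text \<open>Pointwise model of a hypersurface: \<open>D\<close> stands for the differential of the
  parametrization, \<open>n\<close> for the normal. The induced metric may be indefinite, so the
  arguments rest on nondegeneracy instead of positivity.\<close>

locale nonnull_hyperplane =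
  fixes D :: "real ^ 3 \<Rightarrow> real ^ 4" and n :: "real ^ 4"
  assumes linear: "linear D" and inj: "inj D"
    and normal: "\<And>u. lorentz n (D u) = 0" and nonnull: "lorentz n n \<noteq> 0"
begin

text \<open>Dimension count: both sides have dimension 3. Later this exhibits \<open>F 1\<close> as
  a tangent vector of the tube.\<close>

lemma range_eq: "range D = {x. lorentz n x = 0}"
proof (rule subspace_dim_equal)
  show "subspace (range D)"
    using linear by (intro linear_subspace_image) auto
  show "subspace {x. lorentz n x = 0}"
    by (simp add: lorentz_eq_inner subspace_hyperplane)
  show "range D \<subseteq> {x. lorentz n x = 0}"
    using normal by auto
  have "time_reflection n \<noteq> 0"
    using nonnull by (auto simp: lorentz_eq_inner)
  then have "dim {x. lorentz n x = 0} = 3"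
    by (simp add: lorentz_eq_inner dim_hyperplane)
  moreover have "dim (range D) = 3"
    using dim_image_eq[OF linear, of UNIV] inj by simp
  ultimately show "dim {x. lorentz n x = 0} \<le> dim (range D)"
    by simp
qed

text \<open>As \<open>n\<close> is non-null, every vector splits into a multiple of \<open>n\<close>
  and a tangent vector. \<open>V\<close> is orthogonal to both parts, hence to everything.\<close>

lemma orthogonal_tangent_eq_0:
  assumes "lorentz n V = 0" and "\<And>u. lorentz V (D u) = 0"
  shows "V = 0"
proof (rule lorentz_nondegenerate)
  fix y
  let ?y = "y - (lorentz n y / lorentz n n) *\<^sub>R n"
  have "lorentz n ?y = 0"
    using nonnull by (simp add: lorentz.diff_right lorentz.scaleR_right)
  then have "?y \<in> range D"
    by (simp add: range_eq)
  then have "lorentz V ?y = 0"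
    using assms(2) by auto
  then show "lorentz V y = 0"
    using assms(1) by (simp add: lorentz.diff_right lorentz.scaleR_right lorentz_commute[of V n])
qed

text \<open>This justifies the definite description in \<open>hypersurface_gradient\<close>.\<close>

lemma gradient_exists_unique:
  assumes l: "linear l"
  shows "\<exists>!V. V \<in> range D \<and> (\<forall>u. lorentz V (D u) = l u)"
proof (rule ex_ex1I)
  \<comment> \<open>\<open>A\<close> is the Gram matrix of the induced metric. Its kernel consists
    of tangent vectors orthogonal to the tangent space, so it is trivial and the linear system for
    the gradient is solvable.\<close>
  define A :: "real ^ 3 \<Rightarrow> real ^ 3" where "A u = (\<chi> i. lorentz (D u) (D (axis i 1)))" for u
  have expand: "f u = (\<Sum>i\<in>UNIV. u $ i * f (axis i 1))" if "linear f" for f :: "real ^ 3 \<Rightarrow> real" and u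
  proof -
    have "f u = f (\<Sum>i\<in>UNIV. u $ i *\<^sub>R axis i 1)"
      using basis_expansion[of u] by (simp add: scalar_mult_eq_scaleR)
    also have "\<dots> = (\<Sum>i\<in>UNIV. u $ i * f (axis i 1))"
      using that by (simp add: linear_sum linear_cmul)
    finally show ?thesis .
  qed
  have lin: "linear (\<lambda>u. lorentz v (D u))" for v
    using linear by (simp add: linear_iff lorentz.add_right lorentz.scaleR_right)
  have "linear A"
    by (simp add: A_def linear_iff vec_eq_iff linear_add[OF linear] linear_cmul[OF linear]
        lorentz.add_left lorentz.scaleR_left)
  moreover have "inj A"
  proof (subst linear_injective_0[OF \<open>linear A\<close>], intro allI impI)
    fix u assume "A u = 0"
    then have "lorentz (D u) (D v) = 0" for v
      by (subst expand[OF lin]) (simp add: A_def vec_eq_iff)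
    then have "D u = 0"
      by (intro orthogonal_tangent_eq_0 normal)
    then show "u = 0"
      using linear inj by (metis linear_injective_0)
  qed
  ultimately have "surj A"
    by (simp add: linear_injective_imp_surjective)
  then obtain u where u: "A u = (\<chi> i. l (axis i 1))"
    by (metis surjD)
  have "lorentz (D u) (D v) = l v" for v
    using u by (subst expand[OF lin], subst expand[OF l]) (simp add: A_def vec_eq_iff)
  then show "\<exists>V. V \<in> range D \<and> (\<forall>u. lorentz V (D u) = l u)"
    by blast
next
  fix V W
  assume "V \<in> range D \<and> (\<forall>u. lorentz V (D u) = l u)" "W \<in> range D \<and> (\<forall>u. lorentz W (D u) = l u)"
  then have "V - W = 0"
    by (intro orthogonal_tangent_eq_0) (auto simp: range_eq lorentz.diff_right lorentz.diff_left)
  then show "V = W"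
    by simp
qed

end

text \<open>Pairing with \<open>n\<close> removes the tangent gradient and compares the
  coefficients. The gradient must then vanish, which by nondegeneracy means that the differential of
  \<open>f\<close> vanishes.\<close>

lemma gradient_plus_normal_eq_iff:
  assumes "nonnull_hyperplane (frechet_derivative X (at p)) n"
    and "f differentiable (at p)"
  shows "hypersurface_gradient X f p + c *\<^sub>R n = d *\<^sub>R n \<longleftrightarrow>
    frechet_derivative f (at p) = (\<lambda>_. 0) \<and> c = d"
proof -
  interpret nonnull_hyperplane "frechet_derivative X (at p)" n by fact
  have lin: "linear (frechet_derivative f (at p))"
    using assms(2) by (rule linear_frechet_derivative)
  let ?V = "hypersurface_gradient X f p"
  have V: "?V \<in> range (frechet_derivative X (at p))"
    "\<And>u. lorentz ?V (frechet_derivative X (at p) u) = frechet_derivative f (at p) u"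
    using theI'[OF gradient_exists_unique[OF lin]] unfolding hypersurface_gradient_def by blast+
  show ?thesis
  proof
    assume "?V + c *\<^sub>R n = d *\<^sub>R n"
    then have eq: "?V = (d - c) *\<^sub>R n"
      by (simp add: algebra_simps)
    have "lorentz n ?V = 0"
      using V(1) by (simp add: range_eq)
    then have "c = d"
      using nonnull by (simp add: eq lorentz.scaleR_right)
    with eq have "?V = 0"
      by simp
    with V(2) have "frechet_derivative f (at p) u = 0" for u
      by (metis lorentz.zero_left)
    with \<open>c = d\<close> show "frechet_derivative f (at p) = (\<lambda>_. 0) \<and> c = d"
      by auto
  next
    assume *: "frechet_derivative f (at p) = (\<lambda>_. 0) \<and> c = d"
    then have "?V = 0"
      using V by (intro orthogonal_tangent_eq_0) (auto simp: range_eq)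
    with * show "?V + c *\<^sub>R n = d *\<^sub>R n"
      by simp
  qed
qed

section \<open>Curvature coefficients\<close>

lemma subsets_card_lessThan_3:
  "{A. A \<subseteq> {..<3::nat} \<and> card A = 1} = {{0}, {1}, {2}}"
  "{A. A \<subseteq> {..<3::nat} \<and> card A = 2} = {{0, 1}, {0, 2}, {1, 2}}"
  "{A. A \<subseteq> {..<3::nat} \<and> card A = 3} = {{0, 1, 2}}"
proof -
  have *: "{A. A \<subseteq> {..<3::nat} \<and> card A = k} = Set.filter (\<lambda>A. card A = k) (Pow {0, 1, 2})" for k
    by (auto simp: numeral_3_eq_3 lessThan_Suc numeral_2_eq_2)
  show "{A. A \<subseteq> {..<3::nat} \<and> card A = 1} = {{0}, {1}, {2}}"
    "{A. A \<subseteq> {..<3::nat} \<and> card A = 2} = {{0, 1}, {0, 2}, {1, 2}}"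
    "{A. A \<subseteq> {..<3::nat} \<and> card A = 3} = {{0, 1, 2}}"
    unfolding * by (auto simp: Pow_insert card_insert_if)
qed

text \<open>The list of principal curvatures is sorted, so the positions of \<open>a\<close>,
  \<open>b\<close>, \<open>c\<close> in it are unknown; the symmetric functions depend on the
  multiset alone.\<close>

lemma curvature_coeffs_of_three:
  assumes "mset (principal_curvatures X N p) = {#a, b, c#}"
  shows "curvature_coeff X N 1 p = - (a + b + c)"
    "curvature_coeff X N 2 p = a * b + a * c + b * c"
    "curvature_coeff X N 3 p = - (a * b * c)"
proof -
  obtain x y z where xyz: "principal_curvatures X N p = [x, y, z]"
    using arg_cong[OF assms, of size]
    by (auto simp: numeral_3_eq_3 length_Suc_conv)
  have m: "{#x, y, z#} = {#a, b, c#}"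
    using assms xyz by simp
  have e1: "x + y + z = a + b + c" and e3: "x * y * z = a * b * c"
    using arg_cong[OF m, of sum_mset] arg_cong[OF m, of prod_mset] by (simp_all add: add_ac mult_ac)
  \<comment> \<open>The sum of squares can be read off the multiset, and expanding the squared sum
    then yields the second elementary symmetric function.\<close>
  have "x\<^sup>2 + y\<^sup>2 + z\<^sup>2 = a\<^sup>2 + b\<^sup>2 + c\<^sup>2"
    using arg_cong[OF m, of "\<lambda>M. sum_mset (image_mset (\<lambda>t. t\<^sup>2) M)"] by (simp add: add_ac)
  moreover have "(x + y + z)\<^sup>2 = (a + b + c)\<^sup>2"
    using e1 by simp
  ultimately have e2: "x * y + x * z + y * z = a * b + a * c + b * c"
    by (simp add: power2_eq_square algebra_simps)
  show "curvature_coeff X N 1 p = - (a + b + c)"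
    "curvature_coeff X N 2 p = a * b + a * c + b * c"
    "curvature_coeff X N 3 p = - (a * b * c)"
    unfolding curvature_coeff_def xyz Let_def
    using e1 e2 e3 subsets_card_lessThan_3
    by (simp_all add: insert_eq_iff doubleton_eq_iff numeral_3_eq_3[symmetric] flip: One_nat_def)
qed

text \<open>The matrix differs from \<open>c\<close> times the identity only in its first column, so
  it is triangular and its eigenvalues stand on the diagonal.\<close>

lemma proots_charpoly_scaled_rank_one_update:
  fixes e :: "real ^ 3"
  shows "proots (charpoly (matrix (\<lambda>v. c *\<^sub>R (v - v $ 1 *\<^sub>R e)))) = {#c, c, c * (1 - e $ 1)#}"
proof -
  have "charpoly (matrix (\<lambda>v. c *\<^sub>R (v - v $ 1 *\<^sub>R e))) = [:- (c * (1 - e $ 1)), 1:] * [:- c, 1:] * [:- c, 1:]"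
    by (simp add: charpoly_def det_3 matrix_def mat_def map_matrix_def axis_def)
  then show ?thesis
    by (simp add: proots_mult del: mult_pCons_left mult_pCons_right)
qed

section \<open>The profile functions of the tube\<close>

lemma tube_mu_differentiable:
  assumes "j \<in> {2, 3, 4}" and "lam \<in> {1, -1}"
  shows "(\<lambda>p :: real ^ 3. tube_mu j lam i (p $ 2) (p $ 3)) differentiable (at p)"
proof -
  have comp: "(\<lambda>p :: real ^ 3. f (p $ l)) differentiable (at p)"
    if "\<And>x. (f has_field_derivative f' x) (at x)" for f f' :: "real \<Rightarrow> real" and l
    using has_derivative_compose[of "\<lambda>p. p $ l" "\<lambda>p. p $ l" p UNIV f]
      that[unfolded has_field_derivative_def] bounded_linear_vec_nth[THEN bounded_linear_imp_has_derivative]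
    unfolding differentiable_def by blast
  have sinh: "(\<lambda>p :: real ^ 3. sinh (p $ l)) differentiable (at p)" for l
    by (rule comp) (auto intro!: derivative_eq_intros)
  have cosh: "(\<lambda>p :: real ^ 3. cosh (p $ l)) differentiable (at p)" for l
    by (rule comp) (auto intro!: derivative_eq_intros)
  show ?thesis
    using assms sinh cosh
    by (cases "i = j"; cases "i = j + 1 \<or> i + 3 = j + 1"; cases "i = j + 2 \<or> i + 3 = j + 2")
      (auto simp: tube_mu_def intro!: differentiable_mult)
qed

text \<open>The six choices of \<open>j\<close> and \<open>lam\<close> give six different profiles,
  which reduces statements about the second profile function to explicit hyperbolic
  functions.\<close>

lemma tube_mu_2_cases:
  assumes "j \<in> {2, 3, 4}" and "lam \<in> {1, -1}"
  obtains "tube_mu j lam 2 = (\<lambda>t w. sinh w * cosh t)"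
  | "tube_mu j lam 2 = (\<lambda>t w. cosh w * cosh t)"
  | "tube_mu j lam 2 = (\<lambda>t w. sinh w * sinh t)"
  | "tube_mu j lam 2 = (\<lambda>t w. cosh w * sinh t)"
  | "tube_mu j lam 2 = (\<lambda>t w. cosh w)"
  | "tube_mu j lam 2 = (\<lambda>t w. sinh w)"
proof -
  from assms consider "j = 2" "lam = 1" | "j = 2" "lam = -1" | "j = 3" "lam = 1"
    | "j = 3" "lam = -1" | "j = 4" "lam = 1" | "j = 4" "lam = -1"
    by blast
  then show thesis
    by cases (rule that, simp add: tube_mu_def fun_eq_iff)+
qed

text \<open>In \<open>w\<close> the function is a multiple of \<open>sinh\<close> or
  \<open>cosh\<close>; this is the finite-difference form of f'' = f. It excludes non-zero constant
  values.\<close>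

lemma tube_mu_2_shift:
  assumes "j \<in> {2, 3, 4}" and "lam \<in> {1, -1}"
  shows "tube_mu j lam 2 t (w + h) + tube_mu j lam 2 t (w - h) = 2 * cosh h * tube_mu j lam 2 t w"
proof -
  have "sinh (w + h) + sinh (w - h) = 2 * cosh h * sinh w"
    "cosh (w + h) + cosh (w - h) = 2 * cosh h * cosh w"
    by (simp_all add: sinh_add cosh_add sinh_diff cosh_diff)
  then show ?thesis
    by (cases rule: tube_mu_2_cases[OF assms]) (simp_all flip: distrib_right)
qed

text \<open>\<open>cosh\<close> has no zero and \<open>sinh\<close> vanishes only at 0, so moving
  each argument by \<open>h\<close> if necessary avoids all zeros.\<close>

lemma tube_mu_2_nonzero_nearby:
  assumes "j \<in> {2, 3, 4}" and "lam \<in> {1, -1}" and "h \<noteq> 0"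
  shows "\<exists>t'\<in>{t, t + h}. \<exists>w'\<in>{w, w + h}. tube_mu j lam 2 t' w' \<noteq> 0"
  using assms(1,2)
  by (cases rule: tube_mu_2_cases; cases "t = 0"; cases "w = 0") (use assms(3) in auto)


text \<open>The profile functions parametrize part of the unit pseudosphere (\<open>lam = 1\<close>)
  or of the unit hyperbolic space (\<open>lam = -1\<close>) in the span of \<open>F 2\<close>,
  \<open>F 3\<close>, \<open>F 4\<close>.\<close>

lemma tube_mu_norm:
  assumes "j \<in> {2, 3, 4}" and "lam \<in> {1, -1}"
  shows "(if j = 2 then -1 else 1) * (tube_mu j lam 2 t w)\<^sup>2
    + (if j = 3 then -1 else 1) * (tube_mu j lam 3 t w)\<^sup>2
    + (if j = 4 then -1 else 1) * (tube_mu j lam 4 t w)\<^sup>2 = lam"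
proof -
  have *: "(sinh w * sinh t)\<^sup>2 - (sinh w * cosh t)\<^sup>2 + (cosh w)\<^sup>2 = 1"
    "(cosh w * sinh t)\<^sup>2 - (cosh w * cosh t)\<^sup>2 + (sinh w)\<^sup>2 = -1"
    unfolding power_mult_distrib cosh_square_eq by algebra+
  from assms consider "j = 2" "lam = 1" | "j = 2" "lam = -1" | "j = 3" "lam = 1"
    | "j = 3" "lam = -1" | "j = 4" "lam = 1" | "j = 4" "lam = -1"
    by blast
  then show ?thesis
    by cases (use * in \<open>simp_all add: tube_mu_def algebra_simps\<close>)
qed

section \<open>Geometry of the tube\<close>

text \<open>Otherwise the simplifier turns the indices in \<open>F 1\<close> and \<open>k 1\<close> into \<open>Suc 0\<close>.\<close>

declare One_nat_def [simp del]

locale spacelike_tube =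
  fixes j :: nat and lam :: int and r :: real
    and I :: "real set" and U :: "(real ^ 3) set"
    and \<beta> :: "real \<Rightarrow> real ^ 4"
    and F :: "nat \<Rightarrow> real \<Rightarrow> real ^ 4"
    and k :: "nat \<Rightarrow> real \<Rightarrow> real"
  assumes j: "j \<in> {2, 3, 4}"
    and lam: "lam \<in> {1, -1}"
    and r: "r > 0"
    and I: "open I"
    and curve: "spacelike_frenet_curve j I \<beta> F k"
    and U: "open U" "connected U" "(\<lambda>p. p $ 1) ` U = I"
    and immersion: "immersion_on U (tube j lam r \<beta> F)"
begin

abbreviation X where "X \<equiv> tube j lam r \<beta> F"

abbreviation N where "N \<equiv> tube_normal j lam F"

definition Y :: "real ^ 3 \<Rightarrow> real ^ 4" where
  "Y p = (\<Sum>i=2..4. tube_mu j lam i (p $ 2) (p $ 3) *\<^sub>R F i (p $ 1))"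

definition orientation :: real where
  "orientation = - ((-1) ^ fact (4 - j)) * real_of_int lam ^ j"

definition \<kappa> :: real where
  "\<kappa> = - orientation / r"

text \<open>This turns out to be the \<open>F 1\<close> component of the s-derivative of
  \<open>Y\<close>, so \<open>1 + r * \<rho> p\<close> is the focal factor of the tube.\<close>

definition \<rho> :: "real ^ 3 \<Rightarrow> real" where
  "\<rho> p = (-1) ^ fact (4 - j) * k 1 (p $ 1) * tube_mu j lam 2 (p $ 2) (p $ 3)"

text \<open>The principal curvature that differs from \<open>\<kappa>\<close> is \<open>\<kappa> * \<theta> p\<close>.\<close>

definition \<theta> :: "real ^ 3 \<Rightarrow> real" where
  "\<theta> p = 1 - 1 / (1 + r * \<rho> p)"

section \<open>Frame relations and the radial field \<open>Y\<close>\<close>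

lemma X_eq: "X = (\<lambda>p. \<beta> (p $ 1) + r *\<^sub>R Y p)"
  by (simp add: tube_def Y_def fun_eq_iff)

lemma N_eq: "N = (\<lambda>p. orientation *\<^sub>R Y p)"
  by (simp add: tube_normal_def Y_def orientation_def fun_eq_iff)

lemma lam_square: "real_of_int lam * real_of_int lam = 1"
  using lam by auto

lemma orientation_square: "orientation * orientation = 1"
  using lam by (auto simp: orientation_def mult.assoc uminus_power_if)

lemma in_I: "p \<in> U \<Longrightarrow> p $ 1 \<in> I"
  using U(3) by blast

lemma frame:
  assumes "s \<in> I" and "a \<in> {1, 2, 3, 4}" and "b \<in> {1, 2, 3, 4}"
  shows "lorentz (F a s) (F b s) = (if a = b then (if a = j then -1 else 1) else 0)"
proof -
  have "a \<in> {1..4}" "b \<in> {1..4}"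
    using assms by auto
  then show ?thesis
    using curve assms(1) unfolding spacelike_frenet_curve_def orthonormal_frame_def by blast
qed

lemma frame_derivative:
  assumes "s \<in> I" and "i \<in> {1, 2, 3, 4}"
  shows "(F i has_vector_derivative frenet_rhs j F k i s) (at s)"
proof -
  have "i \<in> {1..4}"
    using assms by auto
  then show ?thesis
    using curve assms(1) unfolding spacelike_frenet_curve_def by blast
qed

lemma k1_derivative:
  assumes "s \<in> I"
  obtains k' where "(k 1 has_vector_derivative k') (at s)"
proof -
  have "smooth_curve_on I (k 1)"
    using curve unfolding spacelike_frenet_curve_def by (metis atLeastAtMost_iff le_numeral_extra(4) one_le_numeral)
  then obtain D where D0: "\<And>s. s \<in> I \<Longrightarrow> D 0 s = k 1 s"
    and D: "\<And>n s. s \<in> I \<Longrightarrow> (D n has_vector_derivative D (Suc n) s) (at s)"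
    unfolding smooth_curve_on_def by auto
  \<comment> \<open>\<open>D 0\<close> agrees with \<open>k 1\<close> only on \<open>I\<close>, so
    openness of \<open>I\<close> is used to transfer the derivative.\<close>
  have "(k 1 has_vector_derivative D (Suc 0) s) (at s)"
    by (rule has_vector_derivative_transform_within_open[OF D[OF assms] I assms D0])
  then show ?thesis
    by (rule that)
qed

lemma has_derivative_first_coordinate:
  assumes "(f has_vector_derivative f') (at (p $ 1))"
  shows "((\<lambda>p :: real ^ 3. f (p $ 1)) has_derivative (\<lambda>v. v $ 1 *\<^sub>R f')) (at p)"
  using has_derivative_compose[of "\<lambda>p. p $ 1" "\<lambda>p. p $ 1" p UNIV f]
    assms[unfolded has_vector_derivative_def] bounded_linear_vec_nth[THEN bounded_linear_imp_has_derivative]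
  by blast

lemma Y_expand:
  "Y p = tube_mu j lam 2 (p $ 2) (p $ 3) *\<^sub>R F 2 (p $ 1)
    + tube_mu j lam 3 (p $ 2) (p $ 3) *\<^sub>R F 3 (p $ 1)
    + tube_mu j lam 4 (p $ 2) (p $ 3) *\<^sub>R F 4 (p $ 1)"
proof -
  have "{2..4::nat} = {2, 3, 4}"
    by auto
  then show ?thesis
    by (simp add: Y_def add.assoc)
qed

lemma lorentz_Y_Y:
  assumes "p \<in> U"
  shows "lorentz (Y p) (Y p) = lam"
proof -
  have "lorentz (Y p) (Y p) =
    (if j = 2 then -1 else 1) * (tube_mu j lam 2 (p $ 2) (p $ 3))\<^sup>2
    + (if j = 3 then -1 else 1) * (tube_mu j lam 3 (p $ 2) (p $ 3))\<^sup>2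
    + (if j = 4 then -1 else 1) * (tube_mu j lam 4 (p $ 2) (p $ 3))\<^sup>2"
    using in_I[OF assms]
    by (simp add: Y_expand lorentz.add_left lorentz.add_right lorentz.scaleR_left
        lorentz.scaleR_right frame power2_eq_square)
  then show ?thesis
    by (simp only: tube_mu_norm[OF j lam])
qed

lemma lorentz_Y_F1: "p \<in> U \<Longrightarrow> lorentz (Y p) (F 1 (p $ 1)) = 0"
  by (simp add: Y_expand lorentz.add_left lorentz.scaleR_left frame in_I)

text \<open>The sign is the square of \<open>F 2\<close>: the factorial is 2 for
  \<open>j = 2\<close>, when \<open>F 2\<close> is timelike, and 1 for \<open>j = 3\<close> and
  \<open>j = 4\<close>.\<close>

lemma lorentz_Y_F2:
  "p \<in> U \<Longrightarrow> lorentz (Y p) (F 2 (p $ 1)) = - ((-1) ^ fact (4 - j)) * tube_mu j lam 2 (p $ 2) (p $ 3)"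
  using j by (auto simp: Y_expand lorentz.add_left lorentz.scaleR_left frame in_I fact_numeral)

lemma normal_sign_N: "p \<in> U \<Longrightarrow> normal_sign N p = lam"
  using orientation_square lorentz_Y_Y[of p]
  by (simp add: normal_sign_def N_eq lorentz.scaleR_left lorentz.scaleR_right flip: mult.assoc)

section \<open>Differentials of the radial field, the tube and its normal\<close>

lemma Y_differentiable:
  assumes "p \<in> U"
  shows "Y differentiable (at p)"
proof -
  have F: "(\<lambda>p. F i (p $ 1)) differentiable (at p)" if "i \<in> {1, 2, 3, 4}" for i
    using has_derivative_first_coordinate[OF frame_derivative[OF in_I[OF assms] that]]
    unfolding differentiable_def by blast
  have "Y = (\<lambda>p. tube_mu j lam 2 (p $ 2) (p $ 3) *\<^sub>R F 2 (p $ 1)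
    + tube_mu j lam 3 (p $ 2) (p $ 3) *\<^sub>R F 3 (p $ 1)
    + tube_mu j lam 4 (p $ 2) (p $ 3) *\<^sub>R F 4 (p $ 1))"
    by (rule ext) (rule Y_expand)
  then show ?thesis
    by (simp only:) (intro differentiable_add differentiable_scaleR tube_mu_differentiable[OF j lam] F; simp)
qed

abbreviation "dY p \<equiv> frechet_derivative Y (at p)"

lemma Y_has_derivative: "p \<in> U \<Longrightarrow> (Y has_derivative dY p) (at p)"
  using Y_differentiable frechet_derivative_works by blast

lemma lorentz_Y_dY:
  assumes "p \<in> U"
  shows "lorentz (Y p) (dY p v) = 0"
proof -
  have "((\<lambda>q. lorentz (Y q) (Y q)) has_derivative
      (\<lambda>v. lorentz (Y p) (dY p v) + lorentz (dY p v) (Y p))) (at p)"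
    by (intro lorentz.FDERIV Y_has_derivative assms)
  moreover have "((\<lambda>q. lorentz (Y q) (Y q)) has_derivative (\<lambda>v. 0)) (at p)"
    using lorentz_Y_Y by (intro has_derivative_transform_within_open[OF has_derivative_const U(1) assms]) auto
  ultimately have "(\<lambda>v. lorentz (Y p) (dY p v) + lorentz (dY p v) (Y p)) = (\<lambda>v. 0)"
    by (rule has_derivative_unique)
  from fun_cong[OF this, of v] show ?thesis
    by (simp add: lorentz_commute[of "dY p v"])
qed

text \<open>Differentiating the relation that \<open>Y\<close> is orthogonal to \<open>F 1\<close>
  moves the derivative onto \<open>F 1\<close>, where the Frenet equation leaves only
  \<open>F 2\<close>. No expansion of the differential of \<open>Y\<close> is required.\<close>

lemma lorentz_dY_F1:
  assumes "p \<in> U"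
  shows "lorentz (dY p v) (F 1 (p $ 1)) = v $ 1 * \<rho> p"
proof -
  have "((\<lambda>q. lorentz (Y q) (F 1 (q $ 1))) has_derivative
      (\<lambda>v. lorentz (Y p) (v $ 1 *\<^sub>R frenet_rhs j F k 1 (p $ 1)) + lorentz (dY p v) (F 1 (p $ 1)))) (at p)"
    using assms
    by (intro lorentz.FDERIV Y_has_derivative has_derivative_first_coordinate frame_derivative in_I) auto
  moreover have "((\<lambda>q. lorentz (Y q) (F 1 (q $ 1))) has_derivative (\<lambda>v. 0)) (at p)"
    using lorentz_Y_F1 by (intro has_derivative_transform_within_open[OF has_derivative_const U(1) assms]) auto
  ultimately have "(\<lambda>v. lorentz (Y p) (v $ 1 *\<^sub>R frenet_rhs j F k 1 (p $ 1)) + lorentz (dY p v) (F 1 (p $ 1))) = (\<lambda>v. 0)"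
    by (rule has_derivative_unique)
  from fun_cong[OF this, of v] show ?thesis
    by (simp add: frenet_rhs_def \<rho>_def lorentz.scaleR_right lorentz_Y_F2[OF assms] algebra_simps)
qed

lemma frechet_derivative_X:
  assumes "p \<in> U"
  shows "frechet_derivative X (at p) = (\<lambda>v. v $ 1 *\<^sub>R F 1 (p $ 1) + r *\<^sub>R dY p v)"
proof -
  have "(\<beta> has_vector_derivative F 1 (p $ 1)) (at (p $ 1))"
    using curve in_I[OF assms] unfolding spacelike_frenet_curve_def by blast
  then have "(X has_derivative (\<lambda>v. v $ 1 *\<^sub>R F 1 (p $ 1) + r *\<^sub>R dY p v)) (at p)"
    unfolding X_eq using assms
    by (intro has_derivative_add has_derivative_first_coordinate has_derivative_scaleR_right Y_has_derivative)
  then show ?thesis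
    by (rule frechet_derivative_at[symmetric])
qed

lemma frechet_derivative_N:
  assumes "p \<in> U"
  shows "frechet_derivative N (at p) = (\<lambda>v. orientation *\<^sub>R dY p v)"
proof -
  have "(N has_derivative (\<lambda>v. orientation *\<^sub>R dY p v)) (at p)"
    unfolding N_eq using assms by (intro has_derivative_scaleR_right Y_has_derivative)
  then show ?thesis
    by (rule frechet_derivative_at[symmetric])
qed

section \<open>Shape operator and mean curvatures of the tube\<close>

lemma nonnull_hyperplane_tube:
  assumes "p \<in> U"
  shows "nonnull_hyperplane (frechet_derivative X (at p)) (N p)"
proof (rule nonnull_hyperplane.intro)
  show "linear (frechet_derivative X (at p))" "inj (frechet_derivative X (at p))"
    using immersion assms by (auto simp: immersion_on_def linear_frechet_derivative)
  show "lorentz (N p) (frechet_derivative X (at p) u) = 0" for u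
    using assms
    by (simp add: frechet_derivative_X N_eq lorentz.add_right lorentz.scaleR_left
        lorentz.scaleR_right lorentz_Y_F1 lorentz_Y_dY)
  show "lorentz (N p) (N p) \<noteq> 0"
    using normal_sign_N[OF assms] lam by (auto simp: normal_sign_def)
qed

lemma shape_operator_tube:
  assumes "p \<in> U"
  obtains e where "shape_operator X N p = (\<lambda>v. \<kappa> *\<^sub>R (v - v $ 1 *\<^sub>R e))"
    and "1 + r * \<rho> p \<noteq> 0" and "1 - e $ 1 = \<theta> p"
proof -
  let ?D = "frechet_derivative X (at p)"
  interpret nonnull_hyperplane ?D "N p"
    by (rule nonnull_hyperplane_tube[OF assms])
  have "lorentz (N p) (F 1 (p $ 1)) = 0"
    using lorentz_Y_F1[OF assms] by (simp add: N_eq lorentz.scaleR_left)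
  then obtain e where e: "?D e = F 1 (p $ 1)"
    using range_eq by (metis (mono_tags, lifting) imageE mem_Collect_eq)
  \<comment> \<open>Pairing \<open>?D e\<close> with \<open>F 1\<close> in two ways determines the
    first coordinate of \<open>e\<close> and shows that the focal factor is non-zero: regularity
    follows from the immersion property.\<close>
  have "lorentz (?D e) (F 1 (p $ 1)) = e $ 1 * (1 + r * \<rho> p)"
    using j in_I[OF assms]
    by (auto simp: frechet_derivative_X[OF assms] lorentz.add_left lorentz.scaleR_left
        lorentz_dY_F1[OF assms] frame algebra_simps)
  moreover have "lorentz (?D e) (F 1 (p $ 1)) = 1"
    using j in_I[OF assms] by (auto simp: e frame)
  ultimately have e1: "e $ 1 * (1 + r * \<rho> p) = 1"
    by simp
  then have nz: "1 + r * \<rho> p \<noteq> 0"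
    by auto
  have "?D (\<kappa> *\<^sub>R (v - v $ 1 *\<^sub>R e)) = - frechet_derivative N (at p) v" for v
  proof -
    have "?D (\<kappa> *\<^sub>R (v - v $ 1 *\<^sub>R e)) = \<kappa> *\<^sub>R (?D v - v $ 1 *\<^sub>R ?D e)"
      by (simp add: linear_cmul[OF linear] linear_diff[OF linear])
    also have "\<dots> = (\<kappa> * r) *\<^sub>R dY p v"
      unfolding e by (simp add: frechet_derivative_X[OF assms])
    finally show ?thesis
      using r by (simp add: \<kappa>_def frechet_derivative_N[OF assms])
  qed
  then have "shape_operator X N p v = \<kappa> *\<^sub>R (v - v $ 1 *\<^sub>R e)" for v
    unfolding shape_operator_def by (intro the_equality injD[OF inj]) simp_all
  moreover have "1 - e $ 1 = \<theta> p"
    using e1 nz by (simp add: \<theta>_def field_simps)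
  ultimately show ?thesis
    using nz by (intro that) auto
qed

lemma mset_principal_curvatures:
  assumes "p \<in> U"
  shows "mset (principal_curvatures X N p) = {#\<kappa>, \<kappa>, \<kappa> * \<theta> p#}"
proof -
  obtain e where "shape_operator X N p = (\<lambda>v. \<kappa> *\<^sub>R (v - v $ 1 *\<^sub>R e))" and "1 - e $ 1 = \<theta> p"
    using shape_operator_tube[OF assms] .
  then show ?thesis
    by (simp add: principal_curvatures_def proots_charpoly_scaled_rank_one_update)
qed

text \<open>The second mean curvature is affine in \<open>\<theta>\<close> with non-zero slope, so
  it is constant exactly when \<open>\<theta>\<close> is.\<close>

lemma mean_curvatures:
  assumes "p \<in> U"
  shows "mean_curvature X N 1 p = lam * \<kappa> * (2 + \<theta> p) / 3"
    and "mean_curvature X N 2 p = \<kappa>\<^sup>2 * (1 + 2 * \<theta> p) / 3"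
    and "mean_curvature X N 3 p = lam * \<kappa> ^ 3 * \<theta> p"
proof -
  have "3 choose 1 = (3::nat)" "3 choose 2 = (3::nat)"
    by (simp_all add: numeral_eq_Suc One_nat_def)
  then show "mean_curvature X N 1 p = lam * \<kappa> * (2 + \<theta> p) / 3"
    "mean_curvature X N 2 p = \<kappa>\<^sup>2 * (1 + 2 * \<theta> p) / 3"
    "mean_curvature X N 3 p = lam * \<kappa> ^ 3 * \<theta> p"
    using lam_square
    by (simp_all add: mean_curvature_def normal_sign_N[OF assms]
        curvature_coeffs_of_three[OF mset_principal_curvatures[OF assms]]
        power2_eq_square power3_eq_cube algebra_simps)
qed

section \<open>Reduction of the Gauss map equation to conditions on \<open>\<theta>\<close>\<close>

lemma \<rho>_differentiable:
  assumes "p \<in> U"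
  shows "\<rho> differentiable (at p)"
proof -
  obtain k' where "(k 1 has_vector_derivative k') (at (p $ 1))"
    using k1_derivative[OF in_I[OF assms]] .
  from has_derivative_first_coordinate[OF this] have "(\<lambda>p. k 1 (p $ 1)) differentiable (at p)"
    unfolding differentiable_def by blast
  then show ?thesis
    unfolding \<rho>_def by (intro differentiable_mult tube_mu_differentiable[OF j lam]) auto
qed

lemma mean_curvature_2_differentiable:
  assumes "p \<in> U"
  shows "mean_curvature X N 2 differentiable (at p)"
proof -
  have "1 + r * \<rho> p \<noteq> 0"
    using shape_operator_tube[OF assms] by metis
  then have "(\<lambda>p. \<kappa>\<^sup>2 * (1 + 2 * \<theta> p) / 3) differentiable (at p)"
    unfolding \<theta>_def
    by (intro differentiable_divide differentiable_mult differentiable_add differentiable_diff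
        differentiable_const \<rho>_differentiable assms) auto
  then show ?thesis
    using mean_curvatures(2) unfolding differentiable_def
    by (metis (no_types, lifting) has_derivative_transform_within_open[OF _ U(1) assms])
qed

lemma L1_Gauss_eq_iff:
  assumes "p \<in> U"
  shows "L1_Gauss X N p = m *\<^sub>R N p \<longleftrightarrow>
    frechet_derivative (mean_curvature X N 2) (at p) = (\<lambda>_. 0) \<and>
    m = 2 * real_of_int lam * \<kappa> ^ 3 * (1 + \<theta> p + (\<theta> p)\<^sup>2)"
proof -
  let ?H = "\<lambda>l. mean_curvature X N l p"
  let ?G = "hypersurface_gradient X (mean_curvature X N 2) p"
  let ?c = "3 * ?H 1 * ?H 2 - ?H 3"
  \<comment> \<open>The prefactor in \<open>L1_Gauss\<close> is three times the square of the normal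
    sign.\<close>
  have "- lam * (real (3 choose 2) * - lam) = 3"
    using lam_square by (simp add: numeral_eq_Suc)
  then have "L1_Gauss X N p = 3 *\<^sub>R (?G + ?c *\<^sub>R N p)"
    by (simp add: L1_Gauss_def Let_def normal_sign_N[OF assms])
  then have "L1_Gauss X N p = m *\<^sub>R N p \<longleftrightarrow> 3 *\<^sub>R (?G + ?c *\<^sub>R N p) = 3 *\<^sub>R ((m / 3) *\<^sub>R N p)"
    by simp
  also have "\<dots> \<longleftrightarrow> ?G + ?c *\<^sub>R N p = (m / 3) *\<^sub>R N p"
    by (subst scaleR_cancel_left) simp
  also have "\<dots> \<longleftrightarrow> frechet_derivative (mean_curvature X N 2) (at p) = (\<lambda>_. 0) \<and> ?c = m / 3"
    by (intro gradient_plus_normal_eq_iff nonnull_hyperplane_tube mean_curvature_2_differentiable assms)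
  \<comment> \<open>The identity behind this is (2 + x)(1 + 2x) - 3x = 2(1 + x + x^2).\<close>
  also have "3 * ?c = 2 * real_of_int lam * \<kappa> ^ 3 * (1 + \<theta> p + (\<theta> p)\<^sup>2)"
    by (simp add: mean_curvatures[OF assms] power2_eq_square power3_eq_cube field_simps)
  then have "?c = m / 3 \<longleftrightarrow> m = 2 * real_of_int lam * \<kappa> ^ 3 * (1 + \<theta> p + (\<theta> p)\<^sup>2)"
    by auto
  finally show ?thesis .
qed

section \<open>Constancy of the second mean curvature and vanishing of \<open>k 1\<close>\<close>

lemma \<rho>_constant_if_first_kind:
  assumes "first_kind_L1_global U X N m" and "p \<in> U" and "q \<in> U"
  shows "\<rho> p = \<rho> q"
proof -
  have "(mean_curvature X N 2 has_derivative (\<lambda>_. 0)) (at x)" if "x \<in> U" for x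
    using assms(1) that L1_Gauss_eq_iff[OF that] mean_curvature_2_differentiable[OF that]
    unfolding first_kind_L1_global_def frechet_derivative_works by metis
  then have "mean_curvature X N 2 p = mean_curvature X N 2 q"
    by (intro has_derivative_zero_unique_connected[OF U(1,2)] assms)
  moreover have "\<kappa> \<noteq> 0"
    using r orientation_square by (auto simp: \<kappa>_def)
  ultimately have "\<theta> p = \<theta> q"
    by (simp add: mean_curvatures assms)
  moreover have "1 + r * \<rho> p \<noteq> 0" "1 + r * \<rho> q \<noteq> 0"
    using shape_operator_tube assms by metis+
  ultimately show ?thesis
    \<comment> \<open>\<open>\<theta>\<close> is an injective function of \<open>\<rho>\<close>
      wherever the focal factor is non-zero.\<close>
    using r by (simp add: \<theta>_def field_simps)
qed

text \<open>At fixed \<open>s\<close> with \<open>k 1 s\<close> non-zero, the profile function would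
  be constant on a small box in \<open>t\<close> and \<open>w\<close>. The shift identity forces
  that constant to be 0, yet the box contains a point where the function is non-zero.\<close>

lemma k1_eq_0_if_\<rho>_constant:
  assumes const: "\<And>p q. p \<in> U \<Longrightarrow> q \<in> U \<Longrightarrow> \<rho> p = \<rho> q" and "s \<in> I"
  shows "k 1 s = 0"
proof (rule ccontr)
  assume nz: "k 1 s \<noteq> 0"
  obtain p where p: "p \<in> U" "p $ 1 = s"
    using U(3) \<open>s \<in> I\<close> by blast
  define P :: "real \<Rightarrow> real \<Rightarrow> real ^ 3" where
    "P t w = (\<chi> i. if i = 1 then s else if i = 2 then t else w)" for t w
  have P: "P t w $ 1 = s" "P t w $ 2 = t" "P t w $ 3 = w" for t w
    by (auto simp: P_def)
  let ?t = "p $ 2" and ?w = "p $ 3"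
  let ?\<mu> = "tube_mu j lam 2"
  have "p = P ?t ?w"
    using p(2) by (simp add: vec_eq_iff forall_3 P)
  obtain d where d: "d > 0" "ball p d \<subseteq> U"
    using U(1) p(1) openE by blast
  \<comment> \<open>Both coordinates may move by \<open>h\<close>, and the resulting l1 distance
    \<open>2 * h\<close> stays below \<open>d\<close>.\<close>
  define h where "h = d / 3"
  have h: "h > 0"
    using d by (simp add: h_def)
  have in_U: "P (?t + a) (?w + b) \<in> U" if "\<bar>a\<bar> \<le> h" "\<bar>b\<bar> \<le> h" for a b
  proof -
    have "norm (p - P (?t + a) (?w + b)) \<le> (\<Sum>i\<in>UNIV. \<bar>(p - P (?t + a) (?w + b)) $ i\<bar>)"
      by (rule norm_le_l1_cart)
    also have "\<dots> = \<bar>a\<bar> + \<bar>b\<bar>"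
      by (simp add: sum_3 P p(2))
    also have "\<dots> < d"
      using that h by (simp add: h_def)
    finally show ?thesis
      using d(2) by (auto simp: dist_norm)
  qed
  have \<mu>_const: "?\<mu> (?t + a) (?w + b) = ?\<mu> ?t ?w" if "\<bar>a\<bar> \<le> h" "\<bar>b\<bar> \<le> h" for a b
    using const[OF in_U[OF that] p(1)] nz by (simp add: \<rho>_def P p(2))
  have "2 * ?\<mu> ?t ?w = 2 * cosh h * ?\<mu> ?t ?w"
    using tube_mu_2_shift[OF j lam, of ?t ?w h] \<mu>_const[of 0 h] \<mu>_const[of 0 "- h"] h by simp
  moreover have "cosh h \<noteq> 1"
    using h using cosh_square_eq[of h] by auto
  ultimately have "?\<mu> ?t ?w = 0"
    by auto
  moreover obtain a b where "a \<in> {0, h}" "b \<in> {0, h}" "?\<mu> (?t + a) (?w + b) \<noteq> 0"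
    using tube_mu_2_nonzero_nearby[OF j lam, of h ?t ?w] h by fastforce
  ultimately show False
    using \<mu>_const[of a b] h by auto
qed

text \<open>Here the principal curvatures are \<kappa>, \<kappa>, 0 everywhere, so all mean
  curvatures are constant.\<close>

lemma first_kind_if_k1_eq_0:
  assumes "\<And>s. s \<in> I \<Longrightarrow> k 1 s = 0"
  shows "first_kind_L1_global U X N (2 * real_of_int lam * \<kappa> ^ 3)"
proof -
  have \<theta>: "\<theta> p = 0" if "p \<in> U" for p
    using assms in_I[OF that] by (simp add: \<theta>_def \<rho>_def)
  have "frechet_derivative (mean_curvature X N 2) (at p) = (\<lambda>_. 0)" if "p \<in> U" for p
  proof -
    have "(mean_curvature X N 2 has_derivative (\<lambda>_. 0)) (at p)"
      by (rule has_derivative_transform_within_open[OF has_derivative_const[of "\<kappa>\<^sup>2 / 3"] U(1) that])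
        (simp add: mean_curvatures(2) \<theta>)
    then show ?thesis
      by (rule frechet_derivative_at[symmetric])
  qed
  moreover have "2 * real_of_int lam * \<kappa> ^ 3 \<noteq> 0"
    using r lam orientation_square by (auto simp: \<kappa>_def)
  ultimately show ?thesis
    by (simp add: first_kind_L1_global_def L1_Gauss_eq_iff \<theta>)
qed

lemma first_kind_iff:
  assumes "I \<noteq> {}"
  shows "first_kind_L1_global U X N m \<longleftrightarrow> (\<forall>s\<in>I. k 1 s = 0) \<and> m = 2 * real_of_int lam * \<kappa> ^ 3"
proof
  assume m: "first_kind_L1_global U X N m"
  have k1: "k 1 s = 0" if "s \<in> I" for s
    using \<rho>_constant_if_first_kind[OF m] that by (rule k1_eq_0_if_\<rho>_constant)
  \<comment> \<open>The factor is read off at one point; on an empty domain every non-zero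
    \<open>m\<close> would qualify.\<close>
  obtain p where p: "p \<in> U"
    using assms U(3) by blast
  have "\<theta> p = 0"
    using k1[OF in_I[OF p]] by (simp add: \<theta>_def \<rho>_def)
  then have "m = 2 * real_of_int lam * \<kappa> ^ 3"
    using iffD1[OF L1_Gauss_eq_iff[OF p], of m] m p by (simp add: first_kind_L1_global_def)
  with k1 show "(\<forall>s\<in>I. k 1 s = 0) \<and> m = 2 * real_of_int lam * \<kappa> ^ 3"
    by blast
next
  assume "(\<forall>s\<in>I. k 1 s = 0) \<and> m = 2 * real_of_int lam * \<kappa> ^ 3"
  then show "first_kind_L1_global U X N m"
    using first_kind_if_k1_eq_0 by blast
qed

text \<open>As \<open>orientation\<close> squares to 1, its cube is itself; the remaining factor
  \<open>lam\<close> raises the exponent to \<open>j + 1\<close>.\<close>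

lemma first_kind_factor:
  "2 * real_of_int lam * \<kappa> ^ 3 = 2 * real_of_int lam ^ (j + 1) * (-1) ^ fact (4 - j) / r ^ 3"
proof -
  have "\<kappa> ^ 3 = - orientation * (orientation * orientation) / r ^ 3"
    by (simp add: \<kappa>_def power3_eq_cube)
  then show ?thesis
    unfolding orientation_square by (simp add: orientation_def power_add)
qed

end

theorem theorem11:
  fixes j :: nat and lam :: int and r :: real
    and I :: "real set" and U :: "(real ^ 3) set"
    and \<beta> :: "real \<Rightarrow> real ^ 4"
    and F :: "nat \<Rightarrow> real \<Rightarrow> real ^ 4"
    and k :: "nat \<Rightarrow> real \<Rightarrow> real"
  assumes "j \<in> {2, 3, 4}"
    and "lam \<in> {1, -1}"
    and "r > 0"
    and "open I" and "is_interval I" and "I \<noteq> {}"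
    and "spacelike_frenet_curve j I \<beta> F k"
    and "open U" and "connected U" and "(\<lambda>p. p $ 1) ` U = I"
    and "immersion_on U (tube j lam r \<beta> F)"
  shows "((\<exists>m. first_kind_L1_global U (tube j lam r \<beta> F) (tube_normal j lam F) m)
            \<longleftrightarrow> (\<forall>s\<in>I. k 1 s = 0)) \<and>
         (\<forall>m. first_kind_L1_global U (tube j lam r \<beta> F) (tube_normal j lam F) m
            \<longrightarrow> m = 2 * real_of_int lam ^ (j + 1) * (-1) ^ fact (4 - j) / r ^ 3)"
proof -
  interpret spacelike_tube j lam r I U \<beta> F k
    using assms by unfold_locales
  show ?thesis
    using first_kind_iff[OF \<open>I \<noteq> {}\<close>] unfolding first_kind_factor by blast
qed

end
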